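(* Let $\rhd$ be a total order on disjoint sets. (a) If $\rhd$ is shift-invariant, then $P^{\rhd}$ has a shifted shuffle product: for all set compositions $\Phi$ of $[n]$ and $\Psi$ of $[m]$, $P^{\rhd}_\Phi P^{\rhd}_\Psi=\sum_{\Upsilon\in\Phi\mathbin{\sqcup\!\sqcup}\Psi^{\uparrow n}}P^{\rhd}_\Upsilon$. (b) If $\rhd$ is standard-invariant, then $P^{\rhd}$ has a standardized deconcatenation coproduct: for every set composition $\Phi=B_1|\cdots|B_k$, $\Delta(P^{\rhd}_\Phi)=\sum_{i=0}^kP^{\rhd}_{(B_1|\cdots|B_i)^{\downarrow}}\otimes P^{\rhd}_{(B_{i+1}|\cdots|B_k)^{\downarrow}}$.
   Context: A set composition of $[n]$ is an ordered list $\Phi=(B_1,\dots,B_k)=B_1|\cdots|B_k$ of disjoint nonempty sets with union $[n]$. $\mathrm{NCQSym}$ (over $\mathbb{Q}$) is the Hopf algebra of quasisymmetric functions in noncommuting variables $x_1,x_2,\dots$ with basis $M_\Phi=\sum x_{a_1}x_{a_2}\cdots x_{a_n}$, the sum over all words $(a_1,\dots,a_n)$ of positive integers such that $B_j=\{i: a_i\text{ is the }j\text{-th smallest distinct letter of the word}\}$ and the word has exactly $k$ distinct letters. The product is that of formal power series in noncommuting variables. For a list of disjoint nonempty finite sets of positive integers $(C_1,\dots,C_r)$ with total size $m$, its standardization $(C_1|\cdots|C_r)^{\downarrow}$ is the set composition of $[m]$ obtained by applying the order-preserving bijection $\bigcup C_i\to[m]$. The coproduct is $\Delta(M_\Phi)=\sum_{i=0}^kM_{(B_1|\cdots|B_i)^{\downarrow}}\otimes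 M_{(B_{i+1}|\cdots|B_k)^{\downarrow}}$. $\Psi^{\uparrow n}$ (or $A^{\uparrow n}$ for a set $A$) means adding $n$ to every element. The shuffle (denoted $\mathbin{\sqcup\!\sqcup}$) of two lists of sets is the set of all lists interleaving them, preserving the order within each. A total order on disjoint sets is a relation $\rhd$ on nonempty finite sets of positive integers which restricts to a strict total order on every family of pairwise disjoint sets. It is shift-invariant if $A\rhd B$ implies $A^{\uparrow k}\rhd B^{\uparrow k}$ for all $k$. It is standard-invariant if $A\rhd B$ implies $A^{\downarrow}\rhd B^{\downarrow}$, where $(A^\downarrow,B^\downarrow)$ is the standardization of the pair of disjoint sets $(A,B)$ (jointly). For $\Phi=(B_1,\dots,B_k)$, $P^{\rhd}_\Phi=\sum_\Psi M_\Psi$, the sum over all set compositions $\Psi$ obtained from $\Phi$ by choosing a subset $I$ of $\{i<k: B_i\rhd B_{i+1}\}$ and merging (by union) $B_i$ and $B_{i+1}$ into the same block for every $i\in I$. *)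

theory Defs
  imports Complex_Main "HOL-Library.Function_Algebras" "HOL-Library.Disjoint_Sets"
begin

subsection \<open>Set compositions\<close>

text \<open>The blocks of a composition are disjoint as list entries: \<^const>\<open>partition_on\<close> only
  speaks about the set of blocks, so \<^const>\<open>distinct\<close> is needed in addition.\<close>

definition set_composition :: "nat \<Rightarrow> nat set list \<Rightarrow> bool" where
  "set_composition n \<Phi> \<longleftrightarrow> distinct \<Phi> \<and> partition_on {1..n} (set \<Phi>)"

definition set_compositions :: "nat set list set" where
  "set_compositions = {\<Phi>. \<exists>n. set_composition n \<Phi>}"

definition shift :: "nat \<Rightarrow> nat set \<Rightarrow> nat set" where
  "shift k A = (\<lambda>x. x + k) ` A"

definition rank :: "nat set \<Rightarrow> nat \<Rightarrow> nat" where
  "rank S x = card {y \<in> S. y \<le> x}"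

definition std :: "nat set list \<Rightarrow> nat set list" where
  "std Cs = map (\<lambda>C. rank (\<Union>(set Cs)) ` C) Cs"

lemma rank_strict_mono: "finite S \<Longrightarrow> strict_mono_on S (rank S)"
  unfolding strict_mono_on_def rank_def
proof (intro allI impI, elim conjE, rule psubset_card_mono)
  fix r s assume "r \<in> S" "s \<in> S" "r < s"
  then have "s \<in> {y \<in> S. y \<le> s}" "s \<notin> {y \<in> S. y \<le> r}" "{y \<in> S. y \<le> r} \<subseteq> {y \<in> S. y \<le> s}"
    by auto
  then show "{y \<in> S. y \<le> r} \<subset> {y \<in> S. y \<le> s}" by blast
qed simp

lemma rank_bij:
  assumes "finite S"
  shows "bij_betw (rank S) S {1..card S}"
proof -
  have inj: "inj_on (rank S) S"
    using rank_strict_mono[OF assms] by (rule strict_mono_on_imp_inj_on)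
  have "rank S ` S \<subseteq> {1..card S}"
  proof (rule image_subsetI)
    fix x assume x: "x \<in> S"
    have "{y \<in> S. y \<le> x} \<noteq> {}" "finite {y \<in> S. y \<le> x}" "{y \<in> S. y \<le> x} \<subseteq> S"
      using x assms by auto
    then show "rank S x \<in> {1..card S}"
      unfolding rank_def using assms by (simp add: card_mono Suc_le_eq card_gt_0_iff)
  qed
  moreover have "card (rank S ` S) = card {1..card S}"
    using inj by (simp add: card_image)
  ultimately show ?thesis
    using inj by (simp add: bij_betw_def card_subset_eq)
qed


subsection \<open>Series in noncommuting variables\<close>

text \<open>A formal power series over the rationals in noncommuting variables indexed by positive
  integers is its coefficient function on words. Words are lists of naturals; the ones containing
  the letter 0 get coefficient 0 in all the series below. Addition is pointwise, but the pointwise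
  \<open>(*)\<close> on functions is not the product of series.\<close>

type_synonym series = "nat list \<Rightarrow> rat"

definition series_mult :: "series \<Rightarrow> series \<Rightarrow> series" (infixl "\<odot>" 70) where
  "f \<odot> g = (\<lambda>w. \<Sum>i\<le>length w. f (take i w) * g (drop i w))"

definition word_comp :: "nat list \<Rightarrow> nat set list" where
  "word_comp w = map (\<lambda>a. {i \<in> {1..length w}. w ! (i - 1) = a}) (sorted_list_of_set (set w))"

definition M :: "nat set list \<Rightarrow> series" where
  "M \<Phi> = (\<lambda>w. of_bool (0 \<notin> set w \<and> word_comp w = \<Phi>))"

text \<open>An element of the tensor square of the space of series is represented by its coefficient
  function on pairs of words, that is, as a series in two mutually commuting alphabets. On the
  algebraic tensor product this representation is injective; for the basis at hand see
  \<open>independent_M_tensor_M\<close> below.\<close>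

definition tensor :: "series \<Rightarrow> series \<Rightarrow> (nat list \<times> nat list \<Rightarrow> rat)" (infix "\<otimes>" 75) where
  "f \<otimes> g = (\<lambda>(u, v). f u * g v)"

definition scale :: "rat \<Rightarrow> ('a \<Rightarrow> rat) \<Rightarrow> ('a \<Rightarrow> rat)" where
  "scale c f = (\<lambda>x. c * f x)"

interpretation rat_fun: vector_space scale
  by unfold_locales (auto simp: scale_def fun_eq_iff algebra_simps)

interpretation rat_fun_pair: vector_space_pair scale scale ..

text \<open>The coproduct is the linear extension of its values on the basis \<open>M\<close>. It is meaningful on
  NCQSym, the span of \<open>M ` set_compositions\<close>; outside this span its values are irrelevant.\<close>

definition coproduct_M :: "nat set list \<Rightarrow> (nat list \<times> nat list \<Rightarrow> rat)" where
  "coproduct_M \<Phi> = (\<Sum>i = 0..length \<Phi>. M (std (take i \<Phi>)) \<otimes> M (std (drop i \<Phi>)))"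

definition coproduct :: "series \<Rightarrow> (nat list \<times> nat list \<Rightarrow> rat)" where
  "coproduct = rat_fun_pair.construct (M ` set_compositions)
     (\<lambda>f. coproduct_M (inv_into set_compositions M f))"


subsection \<open>Total orders on disjoint sets and the functions they define\<close>

definition blocks :: "nat set set" where
  "blocks = {A. finite A \<and> A \<noteq> {} \<and> 0 \<notin> A}"

definition total_order_on_disjoint_sets :: "(nat set \<Rightarrow> nat set \<Rightarrow> bool) \<Rightarrow> bool" where
  "total_order_on_disjoint_sets R \<longleftrightarrow>
     (\<forall>F. F \<subseteq> blocks \<and> disjoint F \<longrightarrow> irreflp_on F R \<and> transp_on F R \<and> totalp_on F R)"

definition shift_invariant :: "(nat set \<Rightarrow> nat set \<Rightarrow> bool) \<Rightarrow> bool" where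
  "shift_invariant R \<longleftrightarrow>
     (\<forall>A \<in> blocks. \<forall>B \<in> blocks. R A B \<longrightarrow> (\<forall>k. R (shift k A) (shift k B)))"

definition standard_invariant :: "(nat set \<Rightarrow> nat set \<Rightarrow> bool) \<Rightarrow> bool" where
  "standard_invariant R \<longleftrightarrow>
     (\<forall>A \<in> blocks. \<forall>B \<in> blocks. disjnt A B \<longrightarrow> R A B \<longrightarrow> R (std [A, B] ! 0) (std [A, B] ! 1))"

text \<open>\<open>merge I \<Phi>\<close> merges the blocks \<open>\<Phi> ! i\<close> and \<open>\<Phi> ! Suc i\<close> for all \<open>i \<in> I\<close>; indices start at 0
  and refer to the positions in the original list.\<close>

fun merge :: "nat set \<Rightarrow> nat set list \<Rightarrow> nat set list" where
  "merge I [] = []"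
| "merge I [B] = [B]"
| "merge I (B # C # \<Phi>) =
     (if 0 \<in> I then merge {i. Suc i \<in> I} ((B \<union> C) # \<Phi>)
      else B # merge {i. Suc i \<in> I} (C # \<Phi>))"

definition descents :: "(nat set \<Rightarrow> nat set \<Rightarrow> bool) \<Rightarrow> nat set list \<Rightarrow> nat set" where
  "descents R \<Phi> = {i. Suc i < length \<Phi> \<and> R (\<Phi> ! i) (\<Phi> ! Suc i)}"

definition P :: "(nat set \<Rightarrow> nat set \<Rightarrow> bool) \<Rightarrow> nat set list \<Rightarrow> series" where
  "P R \<Phi> = (\<Sum>\<Psi> \<in> {merge I \<Phi> | I. I \<subseteq> descents R \<Phi>}. M \<Psi>)"


subsection \<open>The coproduct is well defined\<close>

definition comp_word :: "nat \<Rightarrow> nat set list \<Rightarrow> nat list" where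
  "comp_word n \<Phi> = map (\<lambda>i. Suc (THE j. j < length \<Phi> \<and> i \<in> \<Phi> ! j)) [1..<Suc n]"

lemma word_comp_comp_word:
  assumes "set_composition n \<Phi>"
  shows "word_comp (comp_word n \<Phi>) = \<Phi>"
proof -
  have dist: "distinct \<Phi>" and un: "\<Union>(set \<Phi>) = {1..n}" and dj: "disjoint (set \<Phi>)"
    and ne: "{} \<notin> set \<Phi>"
    using assms by (auto simp: set_composition_def partition_on_def)
  define c where "c i = (THE j. j < length \<Phi> \<and> i \<in> \<Phi> ! j)" for i
  have c_eq: "c i = j" if "j < length \<Phi>" "i \<in> \<Phi> ! j" for i j
    unfolding c_def
  proof (rule the_equality)
    fix l assume l: "l < length \<Phi> \<and> i \<in> \<Phi> ! l"
    then have "\<Phi> ! l = \<Phi> ! j"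
      using that dj by (metis disjointD disjoint_iff nth_mem)
    then show "l = j" using dist l that by (simp add: nth_eq_iff_index_eq)
  qed (use that in auto)
  have c_in: "c i < length \<Phi> \<and> i \<in> \<Phi> ! c i" if "i \<in> {1..n}" for i
  proof -
    have "i \<in> \<Union>(set \<Phi>)" using that un by simp
    then obtain j where "j < length \<Phi>" "i \<in> \<Phi> ! j" by (auto simp: in_set_conv_nth)
    then show ?thesis using c_eq by simp
  qed
  have w: "comp_word n \<Phi> = map (\<lambda>i. Suc (c i)) [1..<Suc n]"
    by (simp add: comp_word_def c_def)
  have len: "length (comp_word n \<Phi>) = n" by (simp add: w)
  have nth: "comp_word n \<Phi> ! (i - 1) = Suc (c i)" if "i \<in> {1..n}" for i
    using that unfolding w by (subst nth_map) (auto simp del: upt_Suc)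
  have "c ` {1..n} = {..<length \<Phi>}"
  proof (intro equalityI subsetI)
    fix j assume j: "j \<in> {..<length \<Phi>}"
    then have "\<Phi> ! j \<noteq> {}" using ne by (metis lessThan_iff nth_mem)
    then obtain i where i: "i \<in> \<Phi> ! j" by blast
    then have "i \<in> {1..n}" using un j by (metis UnionI lessThan_iff nth_mem)
    then show "j \<in> c ` {1..n}" using c_eq[of j i] i j by auto
  qed (use c_in in auto)
  moreover have "set (comp_word n \<Phi>) = Suc ` c ` {1..n}"
    unfolding w by (auto simp del: upt_Suc)
  ultimately have st: "set (comp_word n \<Phi>) = {1..<Suc (length \<Phi>)}"
    by (simp add: lessThan_atLeast0)
  have sl: "sorted_list_of_set {1..<Suc (length \<Phi>)} = [1..<Suc (length \<Phi>)]"
    by (rule sorted_list_of_set_range)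
  show ?thesis
  proof (rule nth_equalityI)
    show "length (word_comp (comp_word n \<Phi>)) = length \<Phi>"
      by (simp add: word_comp_def st sl del: upt_Suc)
    fix j assume "j < length (word_comp (comp_word n \<Phi>))"
    then have j: "j < length \<Phi>" by (simp add: word_comp_def st sl del: upt_Suc)
    then have "word_comp (comp_word n \<Phi>) ! j =
        {i \<in> {1..n}. comp_word n \<Phi> ! (i - 1) = Suc j}"
      by (simp add: word_comp_def st sl len del: upt_Suc)
    also have "\<dots> = {i \<in> {1..n}. c i = j}" using nth by auto
    also have "\<dots> = \<Phi> ! j"
    proof (intro equalityI subsetI)
      fix i assume "i \<in> \<Phi> ! j"
      moreover from this have "i \<in> {1..n}" using un nth_mem[OF j] by blast
      ultimately show "i \<in> {i \<in> {1..n}. c i = j}" using c_eq[OF j] by simp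
    qed (use c_in in blast)
    finally show "word_comp (comp_word n \<Phi>) ! j = \<Phi> ! j" .
  qed
qed

lemma exists_word:
  assumes "\<Phi> \<in> set_compositions"
  shows "\<exists>w. \<forall>\<Psi>. M \<Psi> w = of_bool (\<Psi> = \<Phi>)"
proof -
  obtain n where n: "set_composition n \<Phi>" using assms by (auto simp: set_compositions_def)
  have "0 \<notin> set (comp_word n \<Phi>)" by (auto simp: comp_word_def simp del: upt_Suc)
  then show ?thesis
    using word_comp_comp_word[OF n] by (intro exI[of _ "comp_word n \<Phi>"]) (auto simp: M_def)
qed

lemma independent_dual:
  assumes "\<And>b. b \<in> B \<Longrightarrow> \<exists>x. \<forall>b' \<in> B. b' x = of_bool (b' = b)"
  shows "rat_fun.independent B"
  unfolding rat_fun.independent_explicit_module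
proof (intro allI impI)
  fix t u v
  assume t: "finite t" "t \<subseteq> B" and z: "(\<Sum>v\<in>t. scale (u v) v) = 0" and v: "v \<in> t"
  obtain x where x: "\<forall>b' \<in> B. b' x = of_bool (b' = v)"
    using assms[OF subsetD[OF t(2) v]] ..
  have "(\<Sum>v\<in>s. scale (u v) v) x = (\<Sum>b\<in>s. u b * b x)" if "finite s" for s
    using that by (induction s rule: finite_induct) (auto simp: scale_def)
  from this[OF t(1)] have "0 = (\<Sum>b\<in>t. u b * b x)" unfolding z by simp
  also have "\<dots> = (\<Sum>b\<in>t. if b = v then u b else 0)"
  proof (rule sum.cong)
    fix b assume "b \<in> t"
    then have "b x = of_bool (b = v)" using bspec[OF x subsetD[OF t(2)]] by simp
    then show "u b * b x = (if b = v then u b else 0)" by (cases "b = v") simp_all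
  qed simp
  also have "\<dots> = u v" using t v by simp
  finally show "u v = 0" by simp
qed

lemma inj_on_M: "inj_on M set_compositions"
proof (rule inj_onI)
  fix \<Phi> \<Psi> assume a: "\<Phi> \<in> set_compositions" "M \<Phi> = M \<Psi>"
  obtain w where w: "\<forall>\<Psi>. M \<Psi> w = of_bool (\<Psi> = \<Phi>)"
    using exists_word[OF a(1)] ..
  have "of_bool (\<Psi> = \<Phi>) = M \<Psi> w" using w by simp
  also have "\<dots> = 1" using w unfolding a(2)[symmetric] by simp
  finally show "\<Phi> = \<Psi>" by simp
qed

lemma independent_M: "rat_fun.independent (M ` set_compositions)"
proof (rule independent_dual)
  fix b assume "b \<in> M ` set_compositions"
  then obtain \<Phi> where \<Phi>: "b = M \<Phi>" "\<Phi> \<in> set_compositions" by blast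
  obtain w where w: "\<forall>\<Psi>. M \<Psi> w = of_bool (\<Psi> = \<Phi>)"
    using exists_word[OF \<Phi>(2)] ..
  have "M \<Psi> w = of_bool (M \<Psi> = b)" if "\<Psi> \<in> set_compositions" for \<Psi>
    using w inj_on_eq_iff[OF inj_on_M that \<Phi>(2)] \<Phi>(1) by simp
  then show "\<exists>x. \<forall>b' \<in> M ` set_compositions. b' x = of_bool (b' = b)"
    by (intro exI[of _ w] ballI) (elim imageE, simp)
qed

lemma M_tensor_M_dual:
  assumes "\<Phi> \<in> set_compositions" "\<Psi> \<in> set_compositions"
  shows "\<exists>p. \<forall>\<Phi>' \<Psi>'. (M \<Phi>' \<otimes> M \<Psi>') p = of_bool (\<Phi>' = \<Phi> \<and> \<Psi>' = \<Psi>)"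
proof -
  obtain u where u: "\<forall>\<Phi>'. M \<Phi>' u = of_bool (\<Phi>' = \<Phi>)" using exists_word[OF assms(1)] ..
  obtain v where v: "\<forall>\<Psi>'. M \<Psi>' v = of_bool (\<Psi>' = \<Psi>)" using exists_word[OF assms(2)] ..
  show ?thesis using u v by (intro exI[of _ "(u, v)"]) (simp add: tensor_def)
qed

lemma independent_M_tensor_M:
  "inj_on (\<lambda>(\<Phi>, \<Psi>). M \<Phi> \<otimes> M \<Psi>) (set_compositions \<times> set_compositions)"
  "rat_fun.independent ((\<lambda>(\<Phi>, \<Psi>). M \<Phi> \<otimes> M \<Psi>) ` (set_compositions \<times> set_compositions))"
proof -
  show inj: "inj_on (\<lambda>(\<Phi>, \<Psi>). M \<Phi> \<otimes> M \<Psi>) (set_compositions \<times> set_compositions)"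
  proof (rule inj_onI, clarify)
    fix \<Phi> \<Psi> \<Phi>' \<Psi>'
    assume a: "\<Phi> \<in> set_compositions" "\<Psi> \<in> set_compositions" "M \<Phi> \<otimes> M \<Psi> = M \<Phi>' \<otimes> M \<Psi>'"
    obtain p where p: "\<forall>\<Phi>' \<Psi>'. (M \<Phi>' \<otimes> M \<Psi>') p = of_bool (\<Phi>' = \<Phi> \<and> \<Psi>' = \<Psi>)"
      using M_tensor_M_dual[OF a(1,2)] ..
    have "of_bool (\<Phi>' = \<Phi> \<and> \<Psi>' = \<Psi>) = (M \<Phi>' \<otimes> M \<Psi>') p" using p by simp
    also have "\<dots> = 1" using p unfolding a(3)[symmetric] by simp
    finally show "\<Phi> = \<Phi>' \<and> \<Psi> = \<Psi>'" by simp
  qed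
  show "rat_fun.independent ((\<lambda>(\<Phi>, \<Psi>). M \<Phi> \<otimes> M \<Psi>) ` (set_compositions \<times> set_compositions))"
  proof (rule independent_dual, clarify)
    fix \<Phi> \<Psi> assume a: "\<Phi> \<in> set_compositions" "\<Psi> \<in> set_compositions"
    obtain p where p: "\<forall>\<Phi>' \<Psi>'. (M \<Phi>' \<otimes> M \<Psi>') p = of_bool (\<Phi>' = \<Phi> \<and> \<Psi>' = \<Psi>)"
      using M_tensor_M_dual[OF a(1,2)] ..
    have "(M \<Phi>' \<otimes> M \<Psi>') p = of_bool (M \<Phi>' \<otimes> M \<Psi>' = M \<Phi> \<otimes> M \<Psi>)"
      for \<Phi>' \<Psi>'
    proof (cases "\<Phi>' = \<Phi> \<and> \<Psi>' = \<Psi>")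
      case False
      then have "(M \<Phi>' \<otimes> M \<Psi>') p \<noteq> (M \<Phi> \<otimes> M \<Psi>) p" using p by simp
      then have "M \<Phi>' \<otimes> M \<Psi>' \<noteq> M \<Phi> \<otimes> M \<Psi>" by metis
      then show ?thesis using False p by simp
    qed (use p in simp)
    then show "\<exists>x. \<forall>b' \<in> (\<lambda>(\<Phi>, \<Psi>). M \<Phi> \<otimes> M \<Psi>) ` (set_compositions \<times> set_compositions).
        b' x = of_bool (b' = M \<Phi> \<otimes> M \<Psi>)"
      by (intro exI[of _ p] ballI) (elim imageE, simp add: case_prod_beta)
  qed
qed

lemma linear_coproduct: "Vector_Spaces.linear scale scale coproduct"
  unfolding coproduct_def by (rule rat_fun_pair.linear_construct[OF independent_M])

lemma coproduct_M:
  assumes "\<Phi> \<in> set_compositions"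
  shows "coproduct (M \<Phi>) =
    (\<Sum>i = 0..length \<Phi>. M (std (take i \<Phi>)) \<otimes> M (std (drop i \<Phi>)))"
  unfolding coproduct_def
  using assms
  by (simp add: rat_fun_pair.construct_basis[OF independent_M] inj_on_M coproduct_M_def)

end

theory Submission
  imports Defs
begin

text \<open>Merging adjacent blocks of \<open>\<Phi>\<close> amounts to cutting the list \<open>\<Phi>\<close> into nonempty runs along which
  \<open>R\<close> holds, and taking unions of the runs. Cutting a list of runs in two is the same as cutting
  \<open>\<Phi>\<close> in two and cutting each part into runs; this is the coproduct formula, once standardization
  is known to commute with merging and to preserve the positions where merging is allowed.

  For the product, a word \<open>w\<close> occurs in \<open>P R \<Phi>\<close>, with coefficient 1, iff it is constant on the blocks
  of \<open>\<Phi>\<close> and \<open>\<Phi>\<close> is strictly increasing for the lexicographic order on blocks that compares first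
  their letters in \<open>w\<close> and then the blocks by \<open>R\<close>. This order is strict and total on the
  blocks of \<open>\<Phi>\<close> and the shifted blocks of \<open>\<Psi>\<close> together, so two increasing lists have exactly one
  increasing shuffle, and conversely the parts of an increasing shuffle are increasing.\<close>

subsection \<open>Merging adjacent blocks\<close>

definition merges :: "(nat set \<Rightarrow> nat set \<Rightarrow> bool) \<Rightarrow> nat set list \<Rightarrow> nat set list set" where
  "merges R \<Phi> = {merge I \<Phi> | I. I \<subseteq> descents R \<Phi>}"

text \<open>\<open>successively\<close> mirrors \<open>descents\<close>, which compares neighbours
  only. A list of runs stands for the set of descents at which no cut is made.\<close>

definition groupings :: "('a \<Rightarrow> 'a \<Rightarrow> bool) \<Rightarrow> 'a list \<Rightarrow> 'a list list set" where
  "groupings R xs = {Gs. concat Gs = xs \<and> (\<forall>G\<in>set Gs. G \<noteq> [] \<and> successively R G)}"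

definition coarsen :: "'a set list list \<Rightarrow> 'a set list" where
  "coarsen Gs = map (\<lambda>G. \<Union>(set G)) Gs"

lemma coarsen_Cons [simp]: "coarsen (G # Gs) = \<Union>(set G) # coarsen Gs"
  by (simp add: coarsen_def)

lemma Union_coarsen: "\<Union>(set (coarsen Gs)) = \<Union>(set (concat Gs))"
  by (auto simp: coarsen_def)

text \<open>\<open>merge\<close> pushes the union of the first two blocks back onto the list and
  goes on. Whatever is united with the first block stays in the first block of the result, so
  merging can be treated by structural recursion.\<close>

lemma merge_Un_Cons:
  "merge I ((B \<union> C) # \<Phi>) = (B \<union> hd (merge I (C # \<Phi>))) # tl (merge I (C # \<Phi>))"
proof (induction \<Phi> arbitrary: I B C)
  case (Cons D \<Phi>)
  \<comment> \<open>If \<open>0 \<in> I\<close>, both sides absorb \<open>D\<close> into the first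
    block; the two instances pull \<open>B \<union> C\<close> and \<open>C\<close> out
    again.\<close>
  then show ?case
    using Cons[of "{i. Suc i \<in> I}" "B \<union> C" D] Cons[of "{i. Suc i \<in> I}" C D]
    by (simp add: Un_assoc)
qed simp

lemma descents_Cons:
  "descents R (B # C # \<Phi>) = (if R B C then {0} else {}) \<union> Suc ` descents R (C # \<Phi>)"
proof (rule set_eqI)
  fix i show "i \<in> descents R (B # C # \<Phi>) \<longleftrightarrow>
      i \<in> (if R B C then {0} else {}) \<union> Suc ` descents R (C # \<Phi>)"
    by (cases i) (auto simp: descents_def)
qed

text \<open>Neighbours inside a run are joined by an index in \<open>I\<close>, where
  \<open>R\<close> holds. In the induction, \<open>B\<close> is put in front of the first run if
  \<open>0 \<in> I\<close> and is a run of its own otherwise.\<close>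

lemma merge_is_coarsening:
  "I \<subseteq> descents R \<Phi> \<Longrightarrow> \<exists>Gs \<in> groupings R \<Phi>. merge I \<Phi> = coarsen Gs"
proof (induction \<Phi> arbitrary: I rule: induct_list012)
  case 1
  then show ?case by (intro bexI[of _ "[]"]) (auto simp: groupings_def coarsen_def)
next
  case (2 B)
  then show ?case by (intro bexI[of _ "[[B]]"]) (auto simp: groupings_def coarsen_def)
next
  case (3 B C \<Phi>)
  define J where "J = {i. Suc i \<in> I}"
  have "J \<subseteq> descents R (C # \<Phi>)"
    using "3.prems" by (auto simp: J_def descents_Cons split: if_splits)
  from "3.IH"(2)[OF this] obtain Gs
    where Gs: "Gs \<in> groupings R (C # \<Phi>)" "merge J (C # \<Phi>) = coarsen Gs" by blast
  obtain G Gs' where G: "Gs = (C # G) # Gs'"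
    using Gs(1) by (cases Gs; cases "hd Gs") (auto simp: groupings_def)
  show ?case
  proof (cases "0 \<in> I")
    case True
    then have "R B C" using "3.prems" by (auto simp: descents_Cons split: if_splits)
    then have "(B # C # G) # Gs' \<in> groupings R (B # C # \<Phi>)"
      using Gs(1) by (simp add: groupings_def G)
    moreover have "merge I (B # C # \<Phi>) = coarsen ((B # C # G) # Gs')"
      using True Gs(2) by (simp add: J_def merge_Un_Cons G)
    ultimately show ?thesis by blast
  next
    case False
    then have "merge I (B # C # \<Phi>) = coarsen ([B] # Gs)" using Gs(2) by (simp add: J_def)
    moreover have "[B] # Gs \<in> groupings R (B # C # \<Phi>)"
      using Gs(1) by (simp add: groupings_def)
    ultimately show ?thesis by blast
  qed
qed

text \<open>\<open>I\<close> consists of the positions that are not at the end of a run: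
  \<open>0\<close> is included exactly when the run of \<open>B\<close> has a second block, and the
  indices for \<open>C # \<Phi>\<close> move up by one.\<close>

lemma coarsening_is_merge:
  "Gs \<in> groupings R \<Phi> \<Longrightarrow> \<exists>I \<subseteq> descents R \<Phi>. merge I \<Phi> = coarsen Gs"
proof (induction \<Phi> arbitrary: Gs rule: induct_list012)
  case 1
  then have "Gs = []" by (cases Gs) (auto simp: groupings_def)
  then show ?case by (intro exI[of _ "{}"]) (auto simp: coarsen_def)
next
  case (2 B)
  then have "Gs = [[B]]"
    by (cases Gs; cases "tl Gs") (auto simp: groupings_def append_eq_Cons_conv)
  then show ?case by (intro exI[of _ "{}"]) (auto simp: coarsen_def)
next
  case (3 B C \<Phi>)
  obtain G Gs' where G: "Gs = (B # G) # Gs'"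
    using "3.prems" by (cases Gs; cases "hd Gs") (auto simp: groupings_def)
  show ?case
  proof (cases G)
    case Nil
    then have "Gs' \<in> groupings R (C # \<Phi>)" using "3.prems" G by (simp add: groupings_def)
    from "3.IH"(2)[OF this] obtain I
      where "I \<subseteq> descents R (C # \<Phi>)" "merge I (C # \<Phi>) = coarsen Gs'" by blast
    then show ?thesis using Nil G
      by (intro exI[of _ "Suc ` I"]) (auto simp: descents_Cons image_iff)
  next
    case (Cons D G')
    then have D: "D = C" "R B C" "(C # G') # Gs' \<in> groupings R (C # \<Phi>)"
      using "3.prems" G by (auto simp: groupings_def)
    from "3.IH"(2)[OF D(3)] obtain I
      where "I \<subseteq> descents R (C # \<Phi>)" "merge I (C # \<Phi>) = coarsen ((C # G') # Gs')" by blast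
    then show ?thesis using Cons D G
      by (intro exI[of _ "insert 0 (Suc ` I)"])
        (auto simp: descents_Cons image_iff merge_Un_Cons)
  qed
qed

lemma merges_eq_coarsenings: "merges R \<Phi> = coarsen ` groupings R \<Phi>"
proof (intro equalityI subsetI)
  fix \<Psi> assume "\<Psi> \<in> merges R \<Phi>"
  then obtain I where "I \<subseteq> descents R \<Phi>" "\<Psi> = merge I \<Phi>" by (auto simp: merges_def)
  then show "\<Psi> \<in> coarsen ` groupings R \<Phi>" using merge_is_coarsening by blast
next
  fix \<Psi> assume "\<Psi> \<in> coarsen ` groupings R \<Phi>"
  then obtain I where "I \<subseteq> descents R \<Phi>" "\<Psi> = merge I \<Phi>" using coarsening_is_merge by (metis imageE)
  then show "\<Psi> \<in> merges R \<Phi>" unfolding merges_def by blast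
qed

lemma finite_merges: "finite (merges R \<Phi>)"
proof -
  have "finite (descents R \<Phi>)"
    by (rule finite_subset[of _ "{..<length \<Phi>}"]) (auto simp: descents_def)
  moreover have "merges R \<Phi> = (\<lambda>I. merge I \<Phi>) ` Pow (descents R \<Phi>)"
    by (auto simp: merges_def)
  ultimately show ?thesis by simp
qed

text \<open>A run is recovered from its union: it lists the blocks of \<Phi> contained in that
  union. A block of another run is disjoint from the union and nonempty, hence not contained in
  it.\<close>

lemma inj_on_coarsen:
  assumes "distinct \<Phi>" "disjoint (set \<Phi>)" "{} \<notin> set \<Phi>"
  shows "inj_on coarsen (groupings R \<Phi>)"
proof (rule inj_on_inverseI)
  fix Gs assume "Gs \<in> groupings R \<Phi>"
  then have \<Phi>: "concat Gs = \<Phi>" by (simp add: groupings_def)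
  have "filter (\<lambda>B. B \<subseteq> \<Union>(set G)) \<Phi> = G" if G: "G \<in> set Gs" for G
  proof -
    obtain Hs Ks where Gs: "Gs = Hs @ G # Ks" using split_list[OF G] by blast
    then have split: "\<Phi> = concat Hs @ G @ concat Ks" using \<Phi> by simp
    have "\<not> B \<subseteq> \<Union>(set G)" if B: "B \<in> set (concat Hs) \<union> set (concat Ks)" for B
    proof -
      have "B \<in> set \<Phi>" "B \<notin> set G" using B assms(1) unfolding split by auto
      moreover have "B \<inter> C = {}" if "C \<in> set G" for C
        using assms(2) \<open>B \<in> set \<Phi>\<close> \<open>B \<notin> set G\<close> that unfolding split
        by (metis Un_iff disjointD set_append)
      moreover have "B \<noteq> {}" using assms(3) \<open>B \<in> set \<Phi>\<close> by auto
      ultimately show ?thesis by blast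
    qed
    then have "filter (\<lambda>B. B \<subseteq> \<Union>(set G)) (concat Hs) = []"
      "filter (\<lambda>B. B \<subseteq> \<Union>(set G)) (concat Ks) = []"
      by (auto simp: filter_empty_conv)
    moreover have "filter (\<lambda>B. B \<subseteq> \<Union>(set G)) G = G" by (auto intro!: filter_True)
    ultimately show ?thesis unfolding split by simp
  qed
  then show "map (\<lambda>X. filter (\<lambda>B. B \<subseteq> X) \<Phi>) (coarsen Gs) = Gs"
    by (simp add: coarsen_def map_idI)
qed

lemma P_eq_sum_groupings:
  assumes "distinct \<Phi>" "disjoint (set \<Phi>)" "{} \<notin> set \<Phi>"
  shows "P R \<Phi> = (\<Sum>Gs\<in>groupings R \<Phi>. M (coarsen Gs))"
  unfolding P_def merges_def[symmetric] merges_eq_coarsenings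
  by (simp add: sum.reindex[OF inj_on_coarsen[OF assms]])

lemma finite_groupings:
  fixes \<Phi> :: "nat set list"
  assumes "distinct \<Phi>" "disjoint (set \<Phi>)" "{} \<notin> set \<Phi>"
  shows "finite (groupings R \<Phi>)"
  using finite_imageD[OF _ inj_on_coarsen[OF assms]] finite_merges[of R \<Phi>]
  by (simp add: merges_eq_coarsenings)

text \<open>A cut of \<open>Gs\<close> after \<open>j\<close> runs amounts to a cut of
  \<open>xs\<close> at the total length of these runs, with a grouping of each part. Nothing is
  required across a cut, so any groupings of the two parts can be joined.\<close>

lemma sum_groupings_split:
  assumes "\<And>i. i \<le> length xs \<Longrightarrow> finite (groupings R (take i xs))"
    "\<And>i. i \<le> length xs \<Longrightarrow> finite (groupings R (drop i xs))" "finite (groupings R xs)"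
  shows "(\<Sum>Gs\<in>groupings R xs. \<Sum>j = 0..length Gs. f (take j Gs) (drop j Gs)) =
    (\<Sum>i = 0..length xs. \<Sum>Gs\<in>groupings R (take i xs). \<Sum>Hs\<in>groupings R (drop i xs). f Gs Hs)"
proof -
  let ?S = "SIGMA Gs : groupings R xs. {0..length Gs}"
  let ?T = "SIGMA i : {0..length xs}. groupings R (take i xs) \<times> groupings R (drop i xs)"
  let ?h = "\<lambda>(Gs, j). (length (concat (take j Gs)), take j Gs, drop j Gs)"
  have split: "concat (take j Gs) @ concat (drop j Gs) = concat Gs" for Gs :: "'a list list" and j
    by (metis append_take_drop_id concat_append)
  \<comment> \<open>The inverse may drop \<open>i\<close>, which is determined by \<open>Gs\<close>
    as the length of \<open>concat Gs\<close>.\<close>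
  have bij: "bij_betw ?h ?S ?T"
  proof (rule bij_betw_byWitness[where f' = "\<lambda>(i, Gs, Hs). (Gs @ Hs, length Gs)"])
    have "(length (concat (take j Gs)), take j Gs, drop j Gs) \<in> ?T"
      if "Gs \<in> groupings R xs" for Gs j
      using that split[of j Gs] by (auto simp: groupings_def dest: in_set_takeD in_set_dropD)
    then show "?h ` ?S \<subseteq> ?T" by auto
    show "(\<lambda>(i, Gs, Hs). (Gs @ Hs, length Gs)) ` ?T \<subseteq> ?S"
      by (auto simp: groupings_def)
  qed (auto simp: groupings_def)
  show ?thesis
    using sum.reindex_bij_betw[OF bij, of "\<lambda>(i, Gs, Hs). f Gs Hs"] assms
    by (simp add: sum.Sigma case_prod_beta sum.cartesian_product)
qed


subsection \<open>The coproduct\<close>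

lemma sum_apply: "sum f A x = (\<Sum>a\<in>A. f a x)"
  by (induction A rule: infinite_finite_induct) auto

lemma sum_tensor_sum:
  "(\<Sum>a\<in>A. f a) \<otimes> (\<Sum>b\<in>B. g b) = (\<Sum>a\<in>A. \<Sum>b\<in>B. f a \<otimes> g b)"
  by (rule ext) (auto simp: tensor_def sum_apply sum_product)

section \<open>Standardization and merging\<close>

lemma merge_map_image: "merge I (map ((`) f) \<Phi>) = map ((`) f) (merge I \<Phi>)"
  by (induction I \<Phi> rule: merge.induct) (auto simp: image_Un)

lemma Union_set_merge: "\<Union>(set (merge I \<Phi>)) = \<Union>(set \<Phi>)"
  by (induction I \<Phi> rule: merge.induct) auto

text \<open>One relabelling, determined by the union of all blocks, is applied to every block.
  Merging does not change that union, and images commute with unions.\<close>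

lemma std_merge: "std (merge I \<Phi>) = merge I (std \<Phi>)"
  by (simp add: std_def Union_set_merge merge_map_image)

text \<open>\<open>rank S\<close> is strictly increasing on \<open>S\<close>, so it does not affect
  the relative position of an element in a subset. Standardizing inside a larger set first thus has
  no effect on a later standardization.\<close>

lemma rank_image:
  assumes "finite S" "T \<subseteq> S" "x \<in> T"
  shows "rank (rank S ` T) (rank S x) = rank T x"
proof -
  have mono: "rank S y \<le> rank S x \<longleftrightarrow> y \<le> x" if "y \<in> S" for y
    using strict_mono_on_less_eq[OF rank_strict_mono[OF assms(1)]] that assms by blast
  have "{z \<in> rank S ` T. z \<le> rank S x} = rank S ` {y \<in> T. y \<le> x}"
    using mono assms by auto
  moreover have "inj_on (rank S) {y \<in> T. y \<le> x}"
    using rank_bij[OF assms(1)] assms(2) by (auto simp: bij_betw_def intro: inj_on_subset)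
  ultimately show ?thesis unfolding rank_def[of "rank S ` T"] rank_def[of T]
    by (simp add: card_image)
qed

text \<open>\<open>standard_invariant\<close> speaks of a pair standardized on its own, whereas the
  blocks of a list are standardized jointly with all the others; this bridges the two.\<close>

lemma std_pair_rank:
  assumes "finite S" "A \<union> B \<subseteq> S"
  shows "std [rank S ` A, rank S ` B] = std [A, B]"
proof -
  have "rank (rank S ` (A \<union> B)) ` rank S ` C = rank (A \<union> B) ` C" if "C \<subseteq> A \<union> B" for C
    using rank_image[OF assms] that by (auto simp: image_image intro!: image_cong)
  then show ?thesis by (simp add: std_def image_Un)
qed

lemma rank_image_block:
  assumes "finite S" "A \<subseteq> S" "A \<noteq> {}"
  shows "rank S ` A \<in> blocks"
proof -
  have "rank S ` A \<subseteq> {1..card S}" using rank_bij[OF assms(1)] assms(2) by (auto simp: bij_betw_def)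
  then show ?thesis using assms by (auto simp: blocks_def intro: finite_subset)
qed

lemma total_orderD:
  assumes "total_order_on_disjoint_sets R" "A \<in> blocks" "B \<in> blocks" "disjnt A B"
  shows "R A B \<longleftrightarrow> \<not> R B A"
proof -
  \<comment> \<open>Blocks are nonempty, so disjoint blocks are distinct and totality applies to
    them.\<close>
  have "{A, B} \<subseteq> blocks \<and> disjoint {A, B}" "A \<noteq> B"
    using assms by (auto simp: disjoint_def disjnt_def blocks_def)
  then have "irreflp_on {A, B} R" "transp_on {A, B} R" "totalp_on {A, B} R"
    using assms(1) unfolding total_order_on_disjoint_sets_def by blast+
  then show ?thesis
    using \<open>A \<noteq> B\<close> transp_onD[of "{A, B}" R A B A] irreflp_onD[of "{A, B}" R A]
      totalp_onD[of "{A, B}" R A B] by blast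
qed

lemma disjnt_rank_image:
  assumes "finite S" "A \<subseteq> S" "B \<subseteq> S" "disjnt A B"
  shows "disjnt (rank S ` A) (rank S ` B)"
proof -
  have "inj_on (rank S) S" using rank_bij[OF assms(1)] by (simp add: bij_betw_def)
  from inj_on_image_Int[OF this assms(2,3)] show ?thesis using assms(4) by (simp add: disjnt_def)
qed

text \<open>Standardization reflects the order as well as preserving it, because the order is total.\<close>

lemma standard_invariant_iff:
  assumes R: "total_order_on_disjoint_sets R" "standard_invariant R"
    and AB: "A \<in> blocks" "B \<in> blocks" "disjnt A B"
  shows "R (std [A, B] ! 0) (std [A, B] ! 1) \<longleftrightarrow> R A B"
proof -
  have fin: "finite (A \<union> B)" and ne: "A \<noteq> {}" "B \<noteq> {}" using AB by (auto simp: blocks_def)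
  have imp: "R A' B' \<Longrightarrow> R (rank (A' \<union> B') ` A') (rank (A' \<union> B') ` B')"
    if "A' \<in> blocks" "B' \<in> blocks" "disjnt A' B'" for A' B'
    using R(2) that by (auto simp: standard_invariant_def std_def)
  let ?A = "rank (A \<union> B) ` A" and ?B = "rank (A \<union> B) ` B"
  have "disjnt ?A ?B" using fin AB(3) by (intro disjnt_rank_image) auto
  moreover have "?A \<in> blocks" "?B \<in> blocks" using fin ne by (auto intro!: rank_image_block)
  ultimately have "R ?A ?B \<longleftrightarrow> \<not> R ?B ?A" using R(1) by (simp add: total_orderD)
  moreover have "R A B \<Longrightarrow> R ?A ?B" using imp AB by blast
  moreover have "R B A \<Longrightarrow> R ?B ?A"
    using imp[of B A] AB by (simp add: Un_commute disjnt_sym)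
  ultimately have "R ?A ?B \<longleftrightarrow> R A B" using total_orderD[OF R(1) AB] by blast
  then show ?thesis by (simp add: std_def)
qed

text \<open>Two neighbours and their images in \<open>std \<Phi>\<close> have the same
  standardization as a pair. By \<open>standard_invariant_iff\<close>, \<open>R\<close> can be read
  off from that pair in both cases.\<close>

lemma descents_std:
  assumes R: "total_order_on_disjoint_sets R" "standard_invariant R"
    and \<Phi>: "distinct \<Phi>" "disjoint (set \<Phi>)" "set \<Phi> \<subseteq> blocks"
  shows "descents R (std \<Phi>) = descents R \<Phi>"
proof -
  let ?S = "\<Union>(set \<Phi>)"
  have fin: "finite ?S" using \<Phi>(3) by (auto simp: blocks_def)
  have "R (rank ?S ` (\<Phi> ! i)) (rank ?S ` (\<Phi> ! Suc i)) \<longleftrightarrow> R (\<Phi> ! i) (\<Phi> ! Suc i)"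
    if i: "Suc i < length \<Phi>" for i
  proof -
    let ?A = "\<Phi> ! i" and ?B = "\<Phi> ! Suc i"
    have AB: "?A \<in> set \<Phi>" "?B \<in> set \<Phi>" using i by auto
    moreover have "?A \<noteq> ?B" using \<Phi>(1) i by (simp add: nth_eq_iff_index_eq)
    ultimately have dj: "disjnt ?A ?B" using \<Phi>(2) by (auto simp: disjnt_def dest: disjointD)
    have bl: "?A \<in> blocks" "?B \<in> blocks" using AB \<Phi>(3) by auto
    have sub: "?A \<subseteq> ?S" "?B \<subseteq> ?S" using AB by auto
    have "?A \<noteq> {}" "?B \<noteq> {}" using bl by (auto simp: blocks_def)
    then have "rank ?S ` ?A \<in> blocks" "rank ?S ` ?B \<in> blocks"
      using fin sub by (auto intro!: rank_image_block)
    moreover have "disjnt (rank ?S ` ?A) (rank ?S ` ?B)"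
      using fin sub dj by (rule disjnt_rank_image)
    moreover have "std [rank ?S ` ?A, rank ?S ` ?B] = std [?A, ?B]"
      using fin sub by (intro std_pair_rank) auto
    ultimately show ?thesis
      using standard_invariant_iff[OF R bl dj]
        standard_invariant_iff[OF R, of "rank ?S ` ?A" "rank ?S ` ?B"] by metis
  qed
  then show ?thesis by (auto simp: descents_def std_def)
qed

text \<open>Fixing the union fixes the relabelling, which is injective on it. Without this,
  \<open>[{1}]\<close> and \<open>[{2}]\<close> would both standardize to
  \<open>[{1}]\<close>.\<close>

lemma inj_on_std: "finite S \<Longrightarrow> inj_on std {\<Phi>. \<Union>(set \<Phi>) = S}"
proof (rule inj_onI, clarify)
  fix \<Phi> \<Psi> :: "nat set list"
  assume fin: "finite (\<Union>(set \<Phi>))" and un: "\<Union>(set \<Psi>) = \<Union>(set \<Phi>)" and eq: "std \<Phi> = std \<Psi>"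
  have "inj_on ((`) (rank (\<Union>(set \<Phi>)))) (Pow (\<Union>(set \<Phi>)))"
    using rank_bij[OF fin] by (auto simp: bij_betw_def intro: inj_on_image_Pow)
  then have "inj_on ((`) (rank (\<Union>(set \<Phi>)))) (set \<Phi> \<union> set \<Psi>)"
    by (rule inj_on_subset) (use un in auto)
  then show "\<Phi> = \<Psi>" using eq un by (simp add: std_def inj_on_map_eq_map)
qed

text \<open>The sum runs over groupings of \<Phi> itself, not of \<open>std \<Phi>\<close>; this is
  the form in which the two halves appear when the coproduct cuts a coarsening.\<close>

lemma P_std_eq_sum_groupings:
  assumes R: "total_order_on_disjoint_sets R" "standard_invariant R"
    and \<Phi>: "distinct \<Phi>" "disjoint (set \<Phi>)" "set \<Phi> \<subseteq> blocks"
  shows "P R (std \<Phi>) = (\<Sum>Gs\<in>groupings R \<Phi>. M (std (coarsen Gs)))"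
proof -
  have ne: "{} \<notin> set \<Phi>" and fin: "finite (\<Union>(set \<Phi>))" using \<Phi>(3) by (auto simp: blocks_def)
  have "merges R (std \<Phi>) = std ` merges R \<Phi>"
    by (auto simp: merges_def descents_std[OF R \<Phi>] simp flip: std_merge)
  moreover have "inj_on std (merges R \<Phi>)"
  proof (rule inj_on_subset[OF inj_on_std[OF fin]])
    show "merges R \<Phi> \<subseteq> {\<Psi>. \<Union>(set \<Psi>) = \<Union>(set \<Phi>)}"
      unfolding merges_def using Union_set_merge by blast
  qed
  ultimately have "P R (std \<Phi>) = (\<Sum>\<Psi>\<in>merges R \<Phi>. M (std \<Psi>))"
    unfolding P_def merges_def[symmetric] by (simp add: sum.reindex)
  then show ?thesis
    by (simp add: merges_eq_coarsenings sum.reindex[OF inj_on_coarsen[OF \<Phi>(1,2) ne]])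
qed

section \<open>Coarsened set compositions and the coproduct of \<open>P\<close>\<close>

lemma set_composition_blocks:
  assumes "set_composition n \<Phi>"
  shows "set \<Phi> \<subseteq> blocks" "distinct \<Phi>" "disjoint (set \<Phi>)" "{} \<notin> set \<Phi>" "\<Union>(set \<Phi>) = {1..n}"
proof -
  show *: "distinct \<Phi>" "disjoint (set \<Phi>)" "{} \<notin> set \<Phi>" "\<Union>(set \<Phi>) = {1..n}"
    using assms by (auto simp: set_composition_def partition_on_def)
  have "B \<subseteq> {1..n}" if "B \<in> set \<Phi>" for B using that *(4) by blast
  then have "finite B \<and> 0 \<notin> B" if "B \<in> set \<Phi>" for B
    using that finite_subset[OF _ finite_atLeastAtMost, of B 1 n] by fastforce
  then show "set \<Phi> \<subseteq> blocks" using *(3) by (auto simp: blocks_def)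
qed

text \<open>The formula for \<open>coproduct\<close> is available only at \<open>M\<close> of a set
  composition, so the index of every term of \<open>P R \<Phi>\<close> has to be one.\<close>

lemma set_composition_coarsen:
  assumes "set_composition n \<Phi>" "Gs \<in> groupings R \<Phi>"
  shows "set_composition n (coarsen Gs)"
proof -
  note c = set_composition_blocks[OF assms(1)]
  have \<Phi>: "concat Gs = \<Phi>" and Gs: "\<forall>G\<in>set Gs. G \<noteq> []" using assms(2) by (auto simp: groupings_def)
  have ne: "\<Union>(set G) \<noteq> {}" if "G \<in> set Gs" for G
  proof -
    obtain B where "B \<in> set G" using Gs \<open>G \<in> set Gs\<close> by (meson ex_in_conv set_empty)
    moreover from this have "B \<noteq> {}" using c(4) \<Phi> that by fastforce
    ultimately show ?thesis by blast
  qed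
  \<comment> \<open>\<open>G\<close> is fixed by its position and \<open>H\<close> stands at any
    other one. This yields disjointness and, since unions of runs are nonempty, also distinctness of
    the entries.\<close>
  have dj: "\<Union>(set G) \<inter> \<Union>(set H) = {}" if "Gs = Ks @ G # Ls" "H \<in> set Ks \<union> set Ls" for Ks G Ls H
  proof -
    have "B \<inter> C = {}" if "B \<in> set G" "C \<in> set H" for B C
    proof (rule disjointD[OF c(3)])
      show "B \<in> set \<Phi>" "C \<in> set \<Phi>" using \<Phi> \<open>Gs = _\<close> \<open>H \<in> _\<close> that by auto
      show "B \<noteq> C" using c(2) \<open>Gs = _\<close> \<open>H \<in> _\<close> that unfolding \<Phi>[symmetric] by auto
    qed
    then show ?thesis by blast
  qed
  have "disjoint (set (coarsen Gs))"
  proof (rule disjointI)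
    fix X Y assume "X \<in> set (coarsen Gs)" "Y \<in> set (coarsen Gs)" "X \<noteq> Y"
    then obtain G H where GH: "G \<in> set Gs" "H \<in> set Gs" "X = \<Union>(set G)" "Y = \<Union>(set H)" "G \<noteq> H"
      by (auto simp: coarsen_def)
    obtain Ks Ls where "Gs = Ks @ G # Ls" using split_list[OF GH(1)] by blast
    with GH dj show "X \<inter> Y = {}" by auto
  qed
  moreover have "distinct (coarsen Gs)"
  proof -
    have "\<Union>(set (Gs ! i)) \<noteq> \<Union>(set (Gs ! j))" if ij: "i < j" "j < length Gs" for i j
    proof -
      have "Gs ! i \<in> set (take j Gs)" using ij by (auto simp: in_set_conv_nth)
      then show ?thesis using dj[OF id_take_nth_drop[OF ij(2)]] ne[OF nth_mem[OF ij(2)]] by blast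
    qed
    then show ?thesis by (auto simp: coarsen_def distinct_conv_nth neq_iff) metis+
  qed
  moreover have "{} \<notin> set (coarsen Gs)" using ne by (auto simp: coarsen_def)
  moreover have "\<Union>(set (coarsen Gs)) = {1..n}" unfolding Union_coarsen \<Phi> by (rule c(5))
  ultimately show ?thesis by (simp add: set_composition_def partition_on_def)
qed

lemma coproduct_P:
  assumes R: "total_order_on_disjoint_sets R" "standard_invariant R" and \<Phi>: "set_composition n \<Phi>"
  shows "coproduct (P R \<Phi>) =
    (\<Sum>i = 0..length \<Phi>. P R (std (take i \<Phi>)) \<otimes> P R (std (drop i \<Phi>)))"
proof -
  note c = set_composition_blocks[OF \<Phi>]
  \<comment> \<open>Prefixes and suffixes of \<Phi> are in general no set compositions before
    standardization, but they keep these properties.\<close>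
  let ?ok = "\<lambda>\<Psi>. distinct \<Psi> \<and> disjoint (set \<Psi>) \<and> set \<Psi> \<subseteq> blocks \<and> {} \<notin> set \<Psi>"
  have ok: "?ok \<Psi>" if "distinct \<Psi>" "set \<Psi> \<subseteq> set \<Phi>" for \<Psi>
    using that c(1,4) pairwise_subset[OF c(3) that(2)] by blast
  have take: "?ok (take i \<Phi>)" and drop: "?ok (drop i \<Phi>)" for i
    by (rule ok; use c(2) in \<open>auto dest: in_set_takeD in_set_dropD\<close>)+
  interpret linear: Vector_Spaces.linear scale scale coproduct
    by (rule linear_coproduct)
  have "coproduct (P R \<Phi>) = (\<Sum>Gs\<in>groupings R \<Phi>. coproduct (M (coarsen Gs)))"
    unfolding P_eq_sum_groupings[OF c(2-4)] by (rule linear.sum)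
  also have "\<dots> = (\<Sum>Gs\<in>groupings R \<Phi>. \<Sum>j = 0..length Gs.
      M (std (coarsen (take j Gs))) \<otimes> M (std (coarsen (drop j Gs))))"
  proof (rule sum.cong[OF refl])
    fix Gs assume "Gs \<in> groupings R \<Phi>"
    then have "coarsen Gs \<in> set_compositions"
      using set_composition_coarsen[OF \<Phi>] by (auto simp: set_compositions_def)
    then show "coproduct (M (coarsen Gs)) =
      (\<Sum>j = 0..length Gs. M (std (coarsen (take j Gs))) \<otimes> M (std (coarsen (drop j Gs))))"
      by (simp add: coproduct_M) (simp add: coarsen_def take_map drop_map)
  qed
  \<comment> \<open>Regroup by the place where the cut between runs divides \<Phi>.\<close>
  also have "\<dots> = (\<Sum>i = 0..length \<Phi>. \<Sum>Gs\<in>groupings R (take i \<Phi>). \<Sum>Hs\<in>groupings R (drop i \<Phi>).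
      M (std (coarsen Gs)) \<otimes> M (std (coarsen Hs)))"
    using take drop c by (intro sum_groupings_split finite_groupings) auto
  also have "\<dots> = (\<Sum>i = 0..length \<Phi>. P R (std (take i \<Phi>)) \<otimes> P R (std (drop i \<Phi>)))"
    using take drop by (intro sum.cong refl) (simp add: P_std_eq_sum_groupings[OF R] sum_tensor_sum)
  finally show ?thesis .
qed


subsection \<open>The product\<close>

text \<open>The minimum is just a choice of representative: the value matters only when \<open>w\<close> is constant
  on the positions in \<open>B\<close>.\<close>

definition letter :: "nat list \<Rightarrow> nat set \<Rightarrow> nat" where
  "letter w B = w ! (Min B - 1)"

definition word_less :: "(nat set \<Rightarrow> nat set \<Rightarrow> bool) \<Rightarrow> nat list \<Rightarrow> nat set \<Rightarrow> nat set \<Rightarrow> bool" where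
  "word_less R w A B \<longleftrightarrow> letter w A < letter w B \<or> letter w A = letter w B \<and> R A B"

definition constant_on_blocks :: "nat list \<Rightarrow> nat set set \<Rightarrow> bool" where
  "constant_on_blocks w F \<longleftrightarrow> (\<forall>B\<in>F. \<forall>i\<in>B. w ! (i - 1) = letter w B)"

section \<open>Sorted lists and their shuffles\<close>

lemma sorted_wrt_concat:
  "sorted_wrt R (concat xss) \<longleftrightarrow> (\<forall>xs\<in>set xss. sorted_wrt R xs) \<and>
     sorted_wrt (\<lambda>xs ys. \<forall>x\<in>set xs. \<forall>y\<in>set ys. R x y) xss"
  by (induction xss) (auto simp: sorted_wrt_append)

text \<open>If the heads differed, each would occur in the tail of the other list, so
  \<open>R\<close> would hold both ways. Asymmetry also excludes repetitions, so removing the common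
  head leaves tails with equal sets.\<close>

lemma sorted_wrt_unique:
  assumes "asymp_on (set xs) R" "sorted_wrt R xs" "sorted_wrt R ys" "set xs = set ys"
  shows "xs = ys"
  using assms
proof (induction xs arbitrary: ys)
  case (Cons x xs)
  then obtain y ys' where ys: "ys = y # ys'" by (cases ys) auto
  have irrefl: "\<not> R z z" if "z \<in> set (x # xs)" for z
    using asymp_onD[OF Cons.prems(1) that that] by blast
  have "x = y"
  proof (rule ccontr)
    assume "x \<noteq> y"
    then have "y \<in> set xs" "x \<in> set ys'" using Cons.prems(4) ys by auto
    then have "R x y" "R y x" using Cons.prems(2,3) ys by auto
    then show False using asymp_onD[OF Cons.prems(1), of x y] \<open>y \<in> set xs\<close> by simp
  qed
  moreover have "x \<notin> set xs" "y \<notin> set ys'"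
    using Cons.prems(2-4) ys irrefl[of x] irrefl[of y] by auto
  ultimately have "set xs = set ys'" using Cons.prems(4) ys by auto
  moreover have "asymp_on (set xs) R" using Cons.prems(1) by (rule asymp_on_subset) auto
  ultimately show ?case using Cons.IH Cons.prems(2,3) ys \<open>x = y\<close> by simp
qed simp

text \<open>As in merge sort, the smaller of the two heads comes first. Transitivity puts it below
  the rest of the other list.\<close>

lemma sorted_shuffle_exists:
  assumes "transp_on (set xs \<union> set ys) R" "\<And>x y. x \<in> set xs \<Longrightarrow> y \<in> set ys \<Longrightarrow> R x y \<or> R y x"
    "sorted_wrt R xs" "sorted_wrt R ys"
  shows "\<exists>zs \<in> shuffles xs ys. sorted_wrt R zs"
  using assms
proof (induction xs ys rule: shuffles.induct)
  case (3 x xs y ys)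
  show ?case
  proof (cases "R x y")
    case True
    have "transp_on (set xs \<union> set (y # ys)) R"
      using "3.prems"(1) by (rule transp_on_subset) auto
    then obtain zs where zs: "zs \<in> shuffles xs (y # ys)" "sorted_wrt R zs"
      using "3.IH"(1) "3.prems" by auto
    have "R x z" if "z \<in> set ys" for z
      using transp_onD[OF "3.prems"(1), of x y z] True "3.prems"(4) that by auto
    then have "sorted_wrt R (x # zs)"
      using zs True "3.prems"(3) by (auto simp: set_shuffles[OF zs(1)])
    then show ?thesis using zs(1) by (intro bexI[of _ "x # zs"]) simp_all
  next
    case False
    then have yx: "R y x" using "3.prems"(2) by auto
    have "transp_on (set (x # xs) \<union> set ys) R"
      using "3.prems"(1) by (rule transp_on_subset) auto
    then obtain zs where zs: "zs \<in> shuffles (x # xs) ys" "sorted_wrt R zs"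
      using "3.IH"(2) "3.prems" by auto
    have "R y z" if "z \<in> set xs" for z
      using transp_onD[OF "3.prems"(1), of y x z] yx "3.prems"(3) that by auto
    then have "sorted_wrt R (y # zs)"
      using zs yx "3.prems"(4) by (auto simp: set_shuffles[OF zs(1)])
    then show ?thesis using zs(1) by (intro bexI[of _ "y # zs"]) simp_all
  qed
qed auto

text \<open>Disjointness allows each component to be recovered from the shuffle by filtering, and
  filtering keeps a list sorted.\<close>

lemma sorted_wrt_shuffle_components:
  assumes "zs \<in> shuffles xs ys" "set xs \<inter> set ys = {}" "sorted_wrt R zs"
  shows "sorted_wrt R xs" "sorted_wrt R ys"
proof -
  have 1: "filter (\<lambda>x. x \<in> set xs) zs \<in> shuffles (filter (\<lambda>x. x \<in> set xs) xs) (filter (\<lambda>x. x \<in> set xs) ys)"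
    and 2: "filter (\<lambda>x. x \<in> set ys) zs \<in> shuffles (filter (\<lambda>x. x \<in> set ys) xs) (filter (\<lambda>x. x \<in> set ys) ys)"
    unfolding filter_shuffles[symmetric] using assms(1) by blast+
  have "filter (\<lambda>x. x \<in> set xs) xs = xs" "filter (\<lambda>x. x \<in> set xs) ys = []"
    "filter (\<lambda>x. x \<in> set ys) ys = ys" "filter (\<lambda>x. x \<in> set ys) xs = []"
    using assms(2) by (auto simp: filter_empty_conv intro: filter_True)
  with 1 2 have "filter (\<lambda>x. x \<in> set xs) zs = xs" "filter (\<lambda>x. x \<in> set ys) zs = ys"
    by simp_all
  then show "sorted_wrt R xs" "sorted_wrt R ys"
    using sorted_wrt_filter[OF assms(3)] by metis+
qed

section \<open>The order on blocks given by a word\<close>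

lemma set_composition_order:
  assumes "total_order_on_disjoint_sets R" "set_composition n \<Phi>"
  shows "irreflp_on (set \<Phi>) R" "transp_on (set \<Phi>) R" "totalp_on (set \<Phi>) R"
  using assms(1) set_composition_blocks(1,3)[OF assms(2)]
  unfolding total_order_on_disjoint_sets_def by blast+

lemma word_less_order:
  assumes "irreflp_on F R" "transp_on F R" "totalp_on F R"
  shows "asymp_on F (word_less R w)" "transp_on F (word_less R w)" "totalp_on F (word_less R w)"
proof -
  have "asymp_on F R" using assms(1,2) by (metis asymp_on_iff_irreflp_on_if_transp_on)
  then show "asymp_on F (word_less R w)"
    unfolding asymp_on_def word_less_def by fastforce
  show "transp_on F (word_less R w)"
  proof (rule transp_onI)
    fix A B C assume F: "A \<in> F" "B \<in> F" "C \<in> F" and "word_less R w A B" "word_less R w B C"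
    then show "word_less R w A C"
      using transp_onD[OF assms(2) F] by (auto simp: word_less_def)
  qed
  show "totalp_on F (word_less R w)"
    using assms(3) by (auto simp: totalp_on_def word_less_def)
qed

section \<open>The words occurring in \<open>P R \<Phi>\<close>\<close>

lemma letter_eqI:
  assumes "B \<in> blocks" "\<And>i. i \<in> B \<Longrightarrow> w ! (i - 1) = a"
  shows "letter w B = a"
  using assms Min_in[of B] by (auto simp: letter_def blocks_def)

definition letter_positions :: "nat list \<Rightarrow> nat \<Rightarrow> nat set" where
  "letter_positions w a = {i \<in> {1..length w}. w ! (i - 1) = a}"

lemma word_comp_alt: "word_comp w = map (letter_positions w) (sorted_list_of_set (set w))"
  by (simp add: word_comp_def letter_positions_def)

lemma Union_word_comp: "\<Union>(set (word_comp w)) = {1..length w}"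
  by (force simp: word_comp_alt letter_positions_def)

text \<open>The \<open>j\<close>-th run covers the positions of the \<open>j\<close>-th letter of
  \<open>w\<close>, so all its blocks carry that letter. Inside a run the letters tie and
  \<open>R\<close> decides; from one run to a later one the letters increase.\<close>

lemma sorted_if_word_comp_coarsening:
  assumes R: "total_order_on_disjoint_sets R" and \<Phi>: "set_composition n \<Phi>"
    and Gs: "Gs \<in> groupings R \<Phi>" "word_comp w = coarsen Gs"
  shows "length w = n \<and> constant_on_blocks w (set \<Phi>) \<and> sorted_wrt (word_less R w) \<Phi>"
proof -
  note c = set_composition_blocks[OF \<Phi>] and o = set_composition_order[OF R \<Phi>]
  define as where "as = sorted_list_of_set (set w)"
  have concat: "concat Gs = \<Phi>" and succ: "\<And>G. G \<in> set Gs \<Longrightarrow> successively R G"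
    using Gs(1) by (auto simp: groupings_def)
  have "{1..length w} = {1..n}"
    using Union_coarsen[of Gs] unfolding Gs(2)[symmetric] Union_word_comp concat c(5) .
  then have len: "length w = n" by (metis card_atLeastAtMost diff_Suc_1)
  have map_eq: "map (letter_positions w) as = map (\<lambda>G. \<Union>(set G)) Gs"
    using Gs(2) by (simp add: word_comp_alt as_def coarsen_def)
  then have len_as: "length as = length Gs" by (metis length_map)
  have positions: "letter_positions w (as ! j) = \<Union>(set (Gs ! j))" if "j < length Gs" for j
    using map_eq that len_as by (metis nth_map)
  have entry: "w ! (i - 1) = as ! j" if "j < length Gs" "B \<in> set (Gs ! j)" "i \<in> B" for i j B
    using positions[OF that(1)] that by (auto simp: letter_positions_def)
  have block: "B \<in> blocks" if "j < length Gs" "B \<in> set (Gs ! j)" for j B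
    using that c(1) unfolding concat[symmetric] by (auto dest: nth_mem)
  have letter: "letter w B = as ! j" if "j < length Gs" "B \<in> set (Gs ! j)" for j B
    using block[OF that] entry[OF that] by (rule letter_eqI)
  have "constant_on_blocks w (set \<Phi>)"
    unfolding constant_on_blocks_def
  proof (intro ballI)
    fix B i assume "B \<in> set \<Phi>" "i \<in> B"
    then obtain j where "j < length Gs" "B \<in> set (Gs ! j)"
      unfolding concat[symmetric] by (auto simp: in_set_conv_nth[of _ Gs])
    then show "w ! (i - 1) = letter w B" using entry letter \<open>i \<in> B\<close> by simp
  qed
  moreover have "sorted_wrt (word_less R w) G" if "G \<in> set Gs" for G
  proof -
    obtain j where j: "j < length Gs" "G = Gs ! j" using \<open>G \<in> set Gs\<close> by (auto simp: in_set_conv_nth)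
    have "set G \<subseteq> set \<Phi>" using \<open>G \<in> set Gs\<close> unfolding concat[symmetric] by auto
    then have "transp_on (set G) R" using o(2) by (rule transp_on_subset[rotated])
    \<comment> \<open>A run is given as increasing between neighbours only; transitivity of
      \<open>R\<close> on the blocks extends this to all pairs.\<close>
    then have "sorted_wrt R G"
      using succ[OF \<open>G \<in> set Gs\<close>] successively_iff_sorted_wrt_strong[of G R] by (meson transp_onD)
    then show ?thesis
      by (rule sorted_wrt_mono_rel[rotated]) (simp add: word_less_def j(2) letter[OF j(1)])
  qed
  moreover have "sorted_wrt (\<lambda>G H. \<forall>A\<in>set G. \<forall>B\<in>set H. word_less R w A B) Gs"
    unfolding sorted_wrt_iff_nth_less
  proof (intro allI impI ballI)
    fix i j A B assume ij: "i < j" "j < length Gs" and "A \<in> set (Gs ! i)" "B \<in> set (Gs ! j)"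
    then have "letter w A = as ! i" "letter w B = as ! j" by (simp_all add: letter)
    moreover have "as ! i < as ! j"
      using ij len_as strict_sorted_list_of_set[of "set w"]
      by (simp add: as_def sorted_wrt_nth_less)
    ultimately show "word_less R w A B" by (simp add: word_less_def)
  qed
  ultimately show ?thesis using len sorted_wrt_concat[of "word_less R w" Gs] concat by simp
qed

text \<open>The runs collect the blocks of \<Phi> by letter, the letters taken in increasing order.
  Their concatenation is increasing for \<open>word_less R w\<close> and has the same blocks as
  \<Phi>, so it is \<Phi> by \<open>sorted_wrt_unique\<close>.\<close>

lemma word_comp_coarsening_if_sorted:
  assumes R: "total_order_on_disjoint_sets R" and \<Phi>: "set_composition n \<Phi>"
    and w: "length w = n" "constant_on_blocks w (set \<Phi>)" "sorted_wrt (word_less R w) \<Phi>"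
  shows "\<exists>Gs \<in> groupings R \<Phi>. word_comp w = coarsen Gs"
proof
  note c = set_composition_blocks[OF \<Phi>] and o = set_composition_order[OF R \<Phi>]
  define as where "as = sorted_list_of_set (set w)"
  define Gs where "Gs = map (\<lambda>a. filter (\<lambda>B. letter w B = a) \<Phi>) as"
  have const: "w ! (i - 1) = letter w B" if "B \<in> set \<Phi>" "i \<in> B" for i B
    using w(2) that by (auto simp: constant_on_blocks_def)
  have set_as: "set as = set w" by (simp add: as_def)
  have letter_in: "letter w B \<in> set w" if B: "B \<in> set \<Phi>" for B
  proof -
    obtain i where i: "i \<in> B" using c(4) B by (metis ex_in_conv)
    then have "i \<in> {1..n}" using c(5) B by blast
    then have "w ! (i - 1) \<in> set w" using w(1) by (intro nth_mem) auto
    then show ?thesis using const[OF B i] by simp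
  qed
  \<comment> \<open>Each position lies in a block of \<Phi>, and by constancy the letter there is
    the letter of the block.\<close>
  have positions: "\<Union>(set (filter (\<lambda>B. letter w B = a) \<Phi>)) = letter_positions w a" for a
  proof -
    have "i \<in> \<Union>(set (filter (\<lambda>B. letter w B = a) \<Phi>)) \<longleftrightarrow> i \<in> \<Union>(set \<Phi>) \<and> w ! (i - 1) = a" for i
      using const by auto
    then show ?thesis unfolding c(5) w(1)[symmetric] letter_positions_def by blast
  qed
  have sorted: "sorted_wrt (word_less R w) (concat Gs)"
    unfolding sorted_wrt_concat
  proof
    show "\<forall>G\<in>set Gs. sorted_wrt (word_less R w) G"
      using sorted_wrt_filter[OF w(3)] by (auto simp: Gs_def)
    show "sorted_wrt (\<lambda>G H. \<forall>A\<in>set G. \<forall>B\<in>set H. word_less R w A B) Gs"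
      unfolding Gs_def sorted_wrt_map
      by (rule sorted_wrt_mono_rel[OF _ strict_sorted_list_of_set[of "set w", folded as_def]])
        (simp add: word_less_def)
  qed
  have "set \<Phi> = set (concat Gs)" using letter_in by (auto simp: Gs_def set_as)
  from sorted_wrt_unique[OF word_less_order(1)[OF o] w(3) sorted this]
  have "concat Gs = \<Phi>" by simp
  moreover have "G \<noteq> [] \<and> successively R G" if G: "G \<in> set Gs" for G
  proof
    obtain a where a: "a \<in> set w" "G = filter (\<lambda>B. letter w B = a) \<Phi>"
      using G by (auto simp: Gs_def set_as)
    have "letter_positions w a \<noteq> {}"
    proof -
      obtain j where "j < length w" "w ! j = a" using a(1) by (auto simp: in_set_conv_nth)
      then have "Suc j \<in> letter_positions w a" by (simp add: letter_positions_def)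
      then show ?thesis by blast
    qed
    then show "G \<noteq> []" unfolding positions[symmetric] a(2)[symmetric] by auto
    have "sorted_wrt (word_less R w) G" unfolding a(2) by (rule sorted_wrt_filter[OF w(3)])
    then have "sorted_wrt R G" by (rule sorted_wrt_mono_rel[rotated]) (auto simp: word_less_def a(2))
    then show "successively R G" by (rule successively_if_sorted_wrt)
  qed
  ultimately show "Gs \<in> groupings R \<Phi>" by (simp add: groupings_def)
  show "word_comp w = coarsen Gs"
    by (simp add: word_comp_alt coarsen_def Gs_def flip: as_def positions)
qed

text \<open>A word has just one \<open>word_comp\<close>, so at most one term of the sum is nonzero
  at \<open>w\<close>. In this form only sortedness depends on the order of the blocks; the other
  conditions are the same for all shuffles.\<close>

lemma P_apply:
  assumes "total_order_on_disjoint_sets R" "set_composition n \<Phi>"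
  shows "P R \<Phi> w = of_bool (length w = n \<and> 0 \<notin> set w \<and> constant_on_blocks w (set \<Phi>) \<and>
    sorted_wrt (word_less R w) \<Phi>)"
proof -
  have "P R \<Phi> w = (\<Sum>\<Psi>\<in>merges R \<Phi>. of_bool (0 \<notin> set w \<and> word_comp w = \<Psi>))"
    by (simp add: P_def merges_def sum_apply M_def)
  also have "\<dots> = of_bool (0 \<notin> set w \<and> word_comp w \<in> merges R \<Phi>)"
    by (cases "0 \<in> set w") (auto simp: finite_merges of_bool_def)
  also have "word_comp w \<in> merges R \<Phi> \<longleftrightarrow> length w = n \<and> constant_on_blocks w (set \<Phi>) \<and>
      sorted_wrt (word_less R w) \<Phi>"
    unfolding merges_eq_coarsenings
    using sorted_if_word_comp_coarsening[OF assms] word_comp_coarsening_if_sorted[OF assms]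
    by (auto simp: image_iff)
  finally show ?thesis by (simp add: conj_ac)
qed

section \<open>Shifted shuffles and the two parts of a word\<close>

lemma set_composition_shuffle:
  assumes "set_composition n \<Phi>" "set_composition m \<Psi>" "\<Upsilon> \<in> shuffles \<Phi> (map (shift n) \<Psi>)"
  shows "set_composition (n + m) \<Upsilon>" "set \<Phi> \<inter> shift n ` set \<Psi> = {}"
proof -
  note c = set_composition_blocks[OF assms(1)] and d = set_composition_blocks[OF assms(2)]
  have inj: "inj (shift n)" by (rule injI) (simp add: shift_def inj_image_eq_iff)
  have un: "\<Union>(shift n ` set \<Psi>) = {n + 1..n + m}"
  proof -
    have "\<Union>(shift n ` set \<Psi>) = (\<lambda>x. x + n) ` \<Union>(set \<Psi>)" by (auto simp: shift_def)
    also have "\<dots> = {n + 1..n + m}" unfolding d(5) by (simp add: add.commute)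
    finally show ?thesis .
  qed
  have ne: "{} \<notin> shift n ` set \<Psi>" using d(4) by (auto simp: shift_def)
  have dj: "A \<inter> B = {}" if "A \<in> set \<Phi>" "B \<in> shift n ` set \<Psi>" for A B
  proof -
    have "A \<subseteq> {1..n}" "B \<subseteq> {n + 1..n + m}" using that un c(5) by blast+
    then show ?thesis by fastforce
  qed
  \<comment> \<open>A block common to both lists would be disjoint from itself, hence empty.\<close>
  show disj: "set \<Phi> \<inter> shift n ` set \<Psi> = {}"
    using dj ne by fastforce
  have set: "set \<Upsilon> = set \<Phi> \<union> shift n ` set \<Psi>" using set_shuffles[OF assms(3)] by simp
  have "distinct \<Upsilon>"
  proof (rule distinct_disjoint_shuffles[OF c(2) _ _ assms(3)])
    show "distinct (map (shift n) \<Psi>)" using d(2) inj_on_subset[OF inj] by (simp add: distinct_map)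
  qed (use disj in simp)
  moreover have "disjoint (shift n ` set \<Psi>)"
  proof (rule disjointI)
    fix A B assume "A \<in> shift n ` set \<Psi>" "B \<in> shift n ` set \<Psi>" "A \<noteq> B"
    then obtain A' B' where AB: "A' \<in> set \<Psi>" "B' \<in> set \<Psi>" "A' \<noteq> B'" "A = shift n A'" "B = shift n B'"
      by blast
    then have "A' \<inter> B' = {}" using d(3) by (simp add: disjointD)
    then show "A \<inter> B = {}" unfolding AB(4,5) shift_def by auto
  qed
  then have "disjoint (set \<Upsilon>)"
    unfolding set using c(3) dj by (intro disjoint_union) blast+
  moreover have "\<Union>(set \<Upsilon>) = {1..n + m}" unfolding set Union_Un_distrib un c(5) by auto
  ultimately show "set_composition (n + m) \<Upsilon>"
    using c(4) ne set by (auto simp: set_composition_def partition_on_def)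
qed

lemma letter_take:
  assumes "B \<subseteq> {1..n}" "B \<noteq> {}"
  shows "letter (take n w) B = letter w B"
proof -
  have "Min B \<in> {1..n}" using assms by (meson Min_in finite_atLeastAtMost finite_subset subsetD)
  then have "Min B - 1 < n" by auto
  then show ?thesis by (simp add: letter_def)
qed

lemma letter_drop:
  assumes "B \<in> blocks" "n \<le> length w"
  shows "letter (drop n w) B = letter w (shift n B)"
proof -
  have fin: "finite B" "B \<noteq> {}" using assms by (auto simp: blocks_def)
  have "Min (shift n B) = Min B + n"
    unfolding shift_def using mono_Min_commute[of "\<lambda>x. x + n" B] fin by (simp add: mono_def)
  \<comment> \<open>Positions start at 1: since \<open>Min B \<noteq> 0\<close>, the truncated
    difference \<open>Min B - 1\<close> plus \<open>n\<close> equals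
    \<open>Min B + n - 1\<close>.\<close>
  moreover have "Min B \<noteq> 0" using Min_in[OF fin] assms(1) by (metis (mono_tags, lifting) blocks_def mem_Collect_eq)
  ultimately show ?thesis using assms(2) by (simp add: letter_def add.commute)
qed

lemma constant_on_blocks_take:
  assumes "\<Union>F = {1..n}" "{} \<notin> F"
  shows "constant_on_blocks (take n w) F \<longleftrightarrow> constant_on_blocks w F"
proof -
  have "(\<forall>i\<in>B. take n w ! (i - 1) = letter (take n w) B) \<longleftrightarrow> (\<forall>i\<in>B. w ! (i - 1) = letter w B)"
    if "B \<in> F" for B
  proof -
    have B: "B \<subseteq> {1..n}" "B \<noteq> {}" using that assms by auto
    then have "take n w ! (i - 1) = w ! (i - 1)" if "i \<in> B" for i using that by force
    then show ?thesis using letter_take[OF B] by simp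
  qed
  then show ?thesis by (simp add: constant_on_blocks_def)
qed

lemma constant_on_blocks_drop:
  assumes "F \<subseteq> blocks" "n \<le> length w"
  shows "constant_on_blocks (drop n w) F \<longleftrightarrow> constant_on_blocks w (shift n ` F)"
proof -
  have "(\<forall>i\<in>B. drop n w ! (i - 1) = letter (drop n w) B) \<longleftrightarrow>
      (\<forall>i\<in>shift n B. w ! (i - 1) = letter w (shift n B))" if "B \<in> F" for B
  proof -
    have B: "B \<in> blocks" using that assms by auto
    have "drop n w ! (i - 1) = w ! (i + n - 1)" if "i \<in> B" for i
      using that B assms(2) by (cases i) (auto simp: blocks_def add.commute)
    then show ?thesis using letter_drop[OF B assms(2)] by (simp add: shift_def)
  qed
  then show ?thesis by (simp add: constant_on_blocks_def)
qed

text \<open>The converse direction comes from shift invariance for the reversed pair, because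
  exactly one of two disjoint blocks precedes the other.\<close>

lemma shift_invariant_iff:
  assumes R: "total_order_on_disjoint_sets R" "shift_invariant R"
    and AB: "A \<in> blocks" "B \<in> blocks" "disjnt A B"
  shows "R (shift n A) (shift n B) \<longleftrightarrow> R A B"
proof -
  have "shift n A \<in> blocks" "shift n B \<in> blocks" "disjnt (shift n A) (shift n B)"
    using AB by (auto simp: blocks_def shift_def disjnt_def)
  then have "R (shift n A) (shift n B) \<longleftrightarrow> \<not> R (shift n B) (shift n A)" using R(1) by (simp add: total_orderD)
  moreover have "R A B \<longleftrightarrow> \<not> R B A" using R(1) AB by (rule total_orderD)
  ultimately show ?thesis using R(2) AB unfolding shift_invariant_def by blast
qed

lemma sorted_wrt_word_less_take:
  assumes "set_composition n \<Phi>"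
  shows "sorted_wrt (word_less R (take n w)) \<Phi> \<longleftrightarrow> sorted_wrt (word_less R w) \<Phi>"
proof -
  note c = set_composition_blocks[OF assms]
  have "letter (take n w) B = letter w B" if "B \<in> set \<Phi>" for B
    by (rule letter_take) (use that c(4,5) in blast)+
  then show ?thesis by (simp add: sorted_wrt_iff_nth_less word_less_def)
qed

text \<open>The letters agree by \<open>letter_drop\<close>. Ties are broken by \<open>R\<close> on
  the blocks on one side and on their shifts on the other, and shift invariance makes these
  agree.\<close>

lemma sorted_wrt_word_less_drop:
  assumes R: "total_order_on_disjoint_sets R" "shift_invariant R"
    and \<Psi>: "set_composition m \<Psi>" and "n \<le> length w"
  shows "sorted_wrt (word_less R (drop n w)) \<Psi> \<longleftrightarrow> sorted_wrt (word_less R w) (map (shift n) \<Psi>)"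
proof -
  note d = set_composition_blocks[OF \<Psi>]
  have "word_less R (drop n w) (\<Psi> ! i) (\<Psi> ! j) \<longleftrightarrow> word_less R w (shift n (\<Psi> ! i)) (shift n (\<Psi> ! j))"
    if ij: "i < j" "j < length \<Psi>" for i j
  proof -
    have bl: "\<Psi> ! i \<in> blocks" "\<Psi> ! j \<in> blocks" using ij d(1) by auto
    have "\<Psi> ! i \<noteq> \<Psi> ! j" using ij d(2) by (simp add: nth_eq_iff_index_eq)
    then have "disjnt (\<Psi> ! i) (\<Psi> ! j)" using ij d(3) by (simp add: disjnt_def disjointD)
    from shift_invariant_iff[OF R bl this] show ?thesis
      by (simp add: word_less_def letter_drop[OF _ assms(4)] bl)
  qed
  then show ?thesis by (simp add: sorted_wrt_iff_nth_less)
qed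

section \<open>Counting increasing shuffles\<close>

lemma sum_of_bool_unique:
  assumes "finite A" "\<And>x y. x \<in> A \<Longrightarrow> y \<in> A \<Longrightarrow> Q x \<Longrightarrow> Q y \<Longrightarrow> x = y"
  shows "(\<Sum>x\<in>A. of_bool (Q x)) = (of_bool (\<exists>x\<in>A. Q x) :: 'b :: semiring_1)"
proof (cases "\<exists>x\<in>A. Q x")
  case True
  then obtain x where x: "x \<in> A" "Q x" by blast
  then have "(\<Sum>y\<in>A. of_bool (Q y) :: 'b) = (\<Sum>y\<in>A. if y = x then 1 else 0)"
    using assms(2) by (intro sum.cong) auto
  then show ?thesis using x assms(1) by auto
qed simp

lemma shuffle_sorted_iff:
  assumes R: "total_order_on_disjoint_sets R" "shift_invariant R"
    and \<Phi>: "set_composition n \<Phi>" and \<Psi>: "set_composition m \<Psi>" and "length w = n + m"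
  shows "(\<exists>\<Upsilon> \<in> shuffles \<Phi> (map (shift n) \<Psi>). sorted_wrt (word_less R w) \<Upsilon>) \<longleftrightarrow>
    sorted_wrt (word_less R (take n w)) \<Phi> \<and> sorted_wrt (word_less R (drop n w)) \<Psi>"
proof -
  let ?X = "shuffles \<Phi> (map (shift n) \<Psi>)"
  \<comment> \<open>A sample shuffle: it is a set composition, so the order properties hold on the
    blocks of both lists together.\<close>
  obtain \<Upsilon>\<^sub>0 where \<Upsilon>\<^sub>0: "\<Upsilon>\<^sub>0 \<in> ?X" by blast
  have set: "set \<Upsilon>\<^sub>0 = set \<Phi> \<union> set (map (shift n) \<Psi>)" using \<Upsilon>\<^sub>0 by (rule set_shuffles)
  have disj: "set \<Phi> \<inter> set (map (shift n) \<Psi>) = {}"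
    using set_composition_shuffle(2)[OF \<Phi> \<Psi> \<Upsilon>\<^sub>0] by simp
  note o = word_less_order[OF set_composition_order[OF R(1) set_composition_shuffle(1)[OF \<Phi> \<Psi> \<Upsilon>\<^sub>0]],
      of w, unfolded set]
  have total: "word_less R w A B \<or> word_less R w B A" if "A \<in> set \<Phi>" "B \<in> set (map (shift n) \<Psi>)" for A B
    using that disj by (intro totalp_onD[OF o(3)]) auto
  have "(\<exists>\<Upsilon> \<in> ?X. sorted_wrt (word_less R w) \<Upsilon>) \<longleftrightarrow>
      sorted_wrt (word_less R w) \<Phi> \<and> sorted_wrt (word_less R w) (map (shift n) \<Psi>)"
    using sorted_shuffle_exists[OF o(2) total] sorted_wrt_shuffle_components[OF _ disj] by blast
  then show ?thesis
    using sorted_wrt_word_less_take[OF \<Phi>] sorted_wrt_word_less_drop[OF R \<Psi>, of n w] assms(5) by simp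
qed

text \<open>For homogeneous series of degrees \<open>n\<close> and \<open>m\<close>, only the
  splitting of a word after \<open>n\<close> letters can contribute.\<close>

lemma series_mult_homogeneous:
  assumes "\<And>w. length w \<noteq> n \<Longrightarrow> f w = 0" "\<And>w. length w \<noteq> m \<Longrightarrow> g w = 0"
  shows "(f \<odot> g) w = (if length w = n + m then f (take n w) * g (drop n w) else 0)"
proof -
  have zero: "f (take i w) * g (drop i w) = 0" if "i \<le> length w" "i \<noteq> n \<or> length w \<noteq> n + m" for i
  proof (cases "i = n")
    case True
    then show ?thesis using that assms(2)[of "drop i w"] by simp
  next
    case False
    then show ?thesis using that assms(1)[of "take i w"] by simp
  qed
  show ?thesis
  proof (cases "length w = n + m")
    case True
    then have "(f \<odot> g) w = (\<Sum>i\<le>length w. if i = n then f (take n w) * g (drop n w) else 0)"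
      unfolding series_mult_def using zero by (intro sum.cong) auto
    then show ?thesis using True by simp
  next
    case False
    then show ?thesis unfolding series_mult_def using zero by (auto intro!: sum.neutral)
  qed
qed

lemma P_mult:
  assumes R: "total_order_on_disjoint_sets R" "shift_invariant R"
    and \<Phi>: "set_composition n \<Phi>" and \<Psi>: "set_composition m \<Psi>"
  shows "P R \<Phi> \<odot> P R \<Psi> = (\<Sum>\<Upsilon> \<in> shuffles \<Phi> (map (shift n) \<Psi>). P R \<Upsilon>)"
proof
  fix w
  let ?X = "shuffles \<Phi> (map (shift n) \<Psi>)"
  let ?F = "set \<Phi> \<union> shift n ` set \<Psi>"
  note c = set_composition_blocks[OF \<Phi>] and d = set_composition_blocks[OF \<Psi>]
  \<comment> \<open>The conditions of \<open>P_apply\<close> that all shuffles share, as they all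
    have the set of blocks \<open>?F\<close>.\<close>
  let ?base = "length w = n + m \<and> 0 \<notin> set w \<and> constant_on_blocks w ?F"
  have "(\<Sum>\<Upsilon> \<in> ?X. P R \<Upsilon>) w = (\<Sum>\<Upsilon> \<in> ?X. of_bool (?base \<and> sorted_wrt (word_less R w) \<Upsilon>))"
    unfolding sum_apply
  proof (rule sum.cong[OF refl])
    fix \<Upsilon> assume "\<Upsilon> \<in> ?X"
    then show "P R \<Upsilon> w = of_bool (?base \<and> sorted_wrt (word_less R w) \<Upsilon>)"
      using P_apply[OF R(1) set_composition_shuffle(1)[OF \<Phi> \<Psi>], of \<Upsilon> w] set_shuffles[of \<Upsilon>]
      by simp
  qed
  \<comment> \<open>All shuffles have the same blocks and \<open>word_less R w\<close> is asymmetric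
    on them, so at most one shuffle is increasing.\<close>
  also have "\<dots> = of_bool (\<exists>\<Upsilon> \<in> ?X. ?base \<and> sorted_wrt (word_less R w) \<Upsilon>)"
  proof (rule sum_of_bool_unique)
    fix \<Upsilon> \<Upsilon>' assume \<Upsilon>: "\<Upsilon> \<in> ?X" "\<Upsilon>' \<in> ?X"
      and base: "?base \<and> sorted_wrt (word_less R w) \<Upsilon>" "?base \<and> sorted_wrt (word_less R w) \<Upsilon>'"
    have "asymp_on (set \<Upsilon>) (word_less R w)"
      by (rule word_less_order(1)[OF set_composition_order[OF R(1)
            set_composition_shuffle(1)[OF \<Phi> \<Psi> \<Upsilon>(1)]]])
    moreover have "set \<Upsilon> = set \<Upsilon>'" unfolding \<Upsilon>[THEN set_shuffles] ..
    ultimately show "\<Upsilon> = \<Upsilon>'"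
      by (rule sorted_wrt_unique[OF _ base(1)[THEN conjunct2] base(2)[THEN conjunct2]])
  qed simp
  also have "\<dots> = (P R \<Phi> \<odot> P R \<Psi>) w"
  proof (cases "length w = n + m")
    case len: True
    \<comment> \<open>Every condition on \<open>w\<close> splits at the cut after \<open>n\<close>
      letters: letters and constancy here, sortedness by \<open>shuffle_sorted_iff\<close>.\<close>
    have set: "set w = set (take n w) \<union> set (drop n w)"
      by (metis append_take_drop_id set_append)
    have const: "constant_on_blocks w ?F \<longleftrightarrow>
        constant_on_blocks (take n w) (set \<Phi>) \<and> constant_on_blocks (drop n w) (set \<Psi>)"
      using len constant_on_blocks_take[OF c(5,4)] constant_on_blocks_drop[OF d(1)]
      by (auto simp: constant_on_blocks_def)
    have "(P R \<Phi> \<odot> P R \<Psi>) w = P R \<Phi> (take n w) * P R \<Psi> (drop n w)"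
      using len by (subst series_mult_homogeneous[of n _ m])
        (auto simp: P_apply[OF R(1) \<Phi>] P_apply[OF R(1) \<Psi>])
    also have "\<dots> = of_bool (\<exists>\<Upsilon> \<in> ?X. ?base \<and> sorted_wrt (word_less R w) \<Upsilon>)"
      using len shuffle_sorted_iff[OF R \<Phi> \<Psi> len]
      by (auto simp: P_apply[OF R(1) \<Phi>] P_apply[OF R(1) \<Psi>] set const)
    finally show ?thesis by simp
  next
    case False
    then show ?thesis
      by (subst series_mult_homogeneous[of n _ m])
        (auto simp: P_apply[OF R(1) \<Phi>] P_apply[OF R(1) \<Psi>])
  qed
  finally show "(P R \<Phi> \<odot> P R \<Psi>) w = (\<Sum>\<Upsilon> \<in> ?X. P R \<Upsilon>) w" by simp
qed

theorem proposition3: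
  fixes R :: "nat set \<Rightarrow> nat set \<Rightarrow> bool"
  assumes "total_order_on_disjoint_sets R"
  shows "(shift_invariant R \<longrightarrow>
           (\<forall>n m \<Phi> \<Psi>. set_composition n \<Phi> \<longrightarrow> set_composition m \<Psi> \<longrightarrow>
             P R \<Phi> \<odot> P R \<Psi> = (\<Sum>\<Upsilon> \<in> shuffles \<Phi> (map (shift n) \<Psi>). P R \<Upsilon>))) \<and>
         (standard_invariant R \<longrightarrow>
           (\<forall>n \<Phi>. set_composition n \<Phi> \<longrightarrow>
             coproduct (P R \<Phi>) =
               (\<Sum>i = 0..length \<Phi>. P R (std (take i \<Phi>)) \<otimes> P R (std (drop i \<Phi>)))))"
  using assms coproduct_P P_mult by blast

end
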